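(* Let $F\colon\mathbb{F}_2^n\to\mathbb{F}_2^2$ be a bent function. Then there are only two possible preimage distributions for $F$, namely: type $(+)$: for some $\alpha\in\mathbb{F}_2^2$, $|F^{-1}(\alpha)|=2^{n-2}+2^{n/2}-2^{n/2-2}$ and $|F^{-1}(\beta)|=2^{n-2}-2^{n/2-2}$ for all $\beta\neq\alpha$; type $(-)$: for some $\alpha\in\mathbb{F}_2^2$, $|F^{-1}(\alpha)|=2^{n-2}-2^{n/2}+2^{n/2-2}$ and $|F^{-1}(\beta)|=2^{n-2}+2^{n/2-2}$ for all $\beta\neq\alpha$. Both distributions occur (for some bent function $\mathbb{F}_2^n\to\mathbb{F}_2^2$) for any even $n\ge4$.
   Context: A function $F\colon\mathbb{F}_2^n\to\mathbb{F}_2^m$ is bent (perfect nonlinear) if $|\{x: F(x+a)-F(x)=b\}|=2^{n-m}$ for all nonzero $a\in\mathbb{F}_2^n$ and all $b\in\mathbb{F}_2^m$. The preimage distribution (value distribution) of $F$ is the multiset of the sizes $|F^{-1}(\beta)|$, $\beta\in\mathbb{F}_2^m$. *)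

theory Defs
  imports "HOL-Analysis.Finite_Cartesian_Product" "HOL-Library.Z2"
begin

text \<open>The field \<open>\<bbbF>\<^sub>2\<close> is \<^typ>\<open>bit\<close>, and \<open>\<bbbF>\<^sub>2\<^sup>n\<close> is \<^typ>\<open>bit ^ 'n\<close> with \<open>n = CARD('n)\<close>.\<close>

text \<open>The quantity \<open>2\<^sup>n\<^sup>-\<^sup>m\<close> is an integer power in \<^typ>\<open>real\<close>, so that nothing is truncated
  when \<open>n < m\<close>.\<close>

definition bent :: "(bit ^ 'n \<Rightarrow> bit ^ 'm) \<Rightarrow> bool" where
  "bent F \<longleftrightarrow> (\<forall>a b. a \<noteq> 0 \<longrightarrow>
     real (card {x. F (x + a) - F x = b}) = 2 powi (int CARD('n) - int CARD('m)))"

text \<open>The exponents \<open>n - 2\<close>, \<open>n/2\<close> and \<open>n/2 - 2\<close> below are real numbers.\<close>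

definition type_plus :: "(bit ^ 'n \<Rightarrow> bit ^ 2) \<Rightarrow> bool" where
  "type_plus F \<longleftrightarrow> (\<exists>\<alpha>.
     real (card (F -` {\<alpha>})) =
       2 powr (real CARD('n) - 2) + 2 powr (real CARD('n) / 2) - 2 powr (real CARD('n) / 2 - 2) \<and>
     (\<forall>\<beta>. \<beta> \<noteq> \<alpha> \<longrightarrow> real (card (F -` {\<beta>})) =
       2 powr (real CARD('n) - 2) - 2 powr (real CARD('n) / 2 - 2)))"

definition type_minus :: "(bit ^ 'n \<Rightarrow> bit ^ 2) \<Rightarrow> bool" where
  "type_minus F \<longleftrightarrow> (\<exists>\<alpha>.
     real (card (F -` {\<alpha>})) =
       2 powr (real CARD('n) - 2) - 2 powr (real CARD('n) / 2) + 2 powr (real CARD('n) / 2 - 2) \<and>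
     (\<forall>\<beta>. \<beta> \<noteq> \<alpha> \<longrightarrow> real (card (F -` {\<beta>})) =
       2 powr (real CARD('n) - 2) + 2 powr (real CARD('n) / 2 - 2)))"

end

theory Submission
  imports Defs "HOL-Analysis.Cartesian_Space"
begin

text \<open>Let \<open>f\<^sub>1, f\<^sub>2\<close> be the components of a bent \<open>F\<close>. The character sums of \<open>f\<^sub>1\<close>, \<open>f\<^sub>2\<close> and
  \<open>f\<^sub>1 + f\<^sub>2\<close> all square to \<open>2\<^sup>n\<close>, and Fourier inversion on \<open>\<bbbF>\<^sub>2\<^sup>2\<close> recovers the fibre sizes from
  their three signs; only the product of the signs matters for the distribution.

  Both types occur as soon as one bent \<open>F\<close> exists: adding a linear form \<open>\<ell>\<close> to \<open>f\<^sub>1\<close> preserves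
  bentness, and by orthogonality the products of the three sums add up to \<open>2\<^sup>2\<^sup>n\<close> over the \<open>2\<^sup>n\<close>
  forms \<open>\<ell>\<close>. Each product is \<open>\<plusminus>2\<^sup>3\<^sup>n\<^sup>/\<^sup>2\<close>, so if all had the same sign the total would have absolute
  value \<open>2\<^sup>5\<^sup>n\<^sup>/\<^sup>2\<close>.

  For \<open>n = 2k\<close> a bent function is \<open>(x, y) \<mapsto> (x \<cdot> y, Mx \<cdot> y)\<close>, where \<open>M\<close> is a \<open>k \<times> k\<close> matrix
  such that \<open>M\<close> and \<open>I + M\<close> are invertible.\<close>

declare add_bit_eq_xor [simp del] mult_bit_eq_and [simp del]

lemma UNIV_bit: "(UNIV :: bit set) = {0, 1}"
  using bit.exhaust by auto

instance bit :: finite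
  by standard (simp add: UNIV_bit)

lemma card_bit [simp]: "CARD(bit) = 2"
  by (simp add: UNIV_bit)

lemma bit_vec_minus: "a - b = a + (b :: bit ^ 'n)"
  by (simp add: vec_eq_iff)

section \<open>Sign characters, Fourier inversion and bentness\<close>

definition chi :: "bit \<Rightarrow> real" where
  "chi b = (if b = 0 then 1 else - 1)"

lemma chi_simps [simp]: "chi 0 = 1" "chi 1 = - 1"
  by (simp_all add: chi_def)

lemma chi_add: "chi (a + b) = chi a * chi b"
  by (cases a; cases b) simp_all

definition wsum :: "bit \<Rightarrow> bit \<Rightarrow> ('a::finite \<Rightarrow> bit ^ 2) \<Rightarrow> real" where
  "wsum c d F = (\<Sum>x\<in>UNIV. chi (c * F x $ 1 + d * F x $ 2))"

text \<open>Fourier inversion on F_2^2: the indicator of \<open>F x = \<beta>\<close> is the product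
  of \<open>(1 + chi (\<beta> $ i) * chi (F x $ i)) / 2\<close> over i = 1, 2. Expand and sum over
  x.\<close>

lemma card_fibre:
  fixes F :: "'a::finite \<Rightarrow> bit ^ 2"
  shows "real (card {x. F x = \<beta>}) =
    (real CARD('a) + chi (\<beta> $ 1) * wsum 1 0 F + chi (\<beta> $ 2) * wsum 0 1 F
      + chi (\<beta> $ 1) * chi (\<beta> $ 2) * wsum 1 1 F) / 4"
proof -
  have pointwise: "of_bool (F x = \<beta>) =
      (1 + chi (\<beta> $ 1) * chi (F x $ 1) + chi (\<beta> $ 2) * chi (F x $ 2)
        + chi (\<beta> $ 1) * chi (\<beta> $ 2) * chi (F x $ 1 + F x $ 2)) / 4" for x
    unfolding vec_eq_iff forall_2
    by (cases "F x $ 1"; cases "F x $ 2"; cases "\<beta> $ 1"; cases "\<beta> $ 2") simp_all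
  have "real (card {x. F x = \<beta>}) = (\<Sum>x\<in>UNIV. of_bool (F x = \<beta>))"
    by simp
  also have "\<dots> = (real CARD('a) + chi (\<beta> $ 1) * wsum 1 0 F + chi (\<beta> $ 2) * wsum 0 1 F
      + chi (\<beta> $ 1) * chi (\<beta> $ 2) * wsum 1 1 F) / 4"
    unfolding pointwise wsum_def
    by (simp add: sum.distrib sum_distrib_left flip: sum_divide_distrib)
  finally show ?thesis .
qed

text \<open>Translation by \<open>v\<close> permutes the group and flips every sign, so the sum
  equals its own negative.\<close>

lemma sum_chi_additive:
  fixes h :: "'a::{finite,ab_group_add} \<Rightarrow> bit"
  assumes add: "\<And>x y. h (x + y) = h x + h y" and v: "h v = 1"
  shows "(\<Sum>x\<in>UNIV. chi (h x)) = 0"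
proof -
  have "(\<Sum>x\<in>UNIV. chi (h x)) = (\<Sum>x\<in>UNIV. chi (h (x + v)))"
    by (rule sum.reindex_bij_witness[of _ "\<lambda>x. x + v" "\<lambda>x. x - v"]) auto
  also have "\<dots> = - (\<Sum>x\<in>UNIV. chi (h x))"
    by (simp add: add v chi_add sum_negf)
  finally show ?thesis by simp
qed

lemma wsum_equidistributed:
  fixes G :: "'a::finite \<Rightarrow> bit ^ 2"
  assumes const: "\<And>b. real (card {x. G x = b}) = r" and cd: "c \<noteq> 0 \<or> d \<noteq> 0"
  shows "wsum c d G = 0"
proof -
  let ?h = "\<lambda>b :: bit ^ 2. c * b $ 1 + d * b $ 2"
  have "wsum c d G = (\<Sum>b\<in>UNIV. real (card {x \<in> UNIV. G x = b}) * chi (?h b))"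
    unfolding wsum_def by (rule sum_fun_comp) auto
  also have "\<dots> = r * (\<Sum>b\<in>UNIV. chi (?h b))"
    by (simp add: const sum_distrib_left)
  also have "(\<Sum>b\<in>UNIV. chi (?h b)) = 0"
  proof (cases "c = 0")
    case False
    then show ?thesis
      by (intro sum_chi_additive[where v = "axis 1 1"]) (auto simp: axis_def algebra_simps)
  next
    case True
    then show ?thesis using cd
      by (intro sum_chi_additive[where v = "axis 2 1"]) (auto simp: axis_def algebra_simps)
  qed
  finally show ?thesis by simp
qed

text \<open>Equidistribution on F_2^2 amounts to the vanishing of all nontrivial character sums: by
  \<open>card_fibre\<close> only the trivial term 2^n / 4 is then left.\<close>

lemma bent_iff_wsum:
  fixes F :: "bit ^ 'n \<Rightarrow> bit ^ 2"
  shows "bent F \<longleftrightarrow>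
    (\<forall>a c d. a \<noteq> 0 \<longrightarrow> c \<noteq> 0 \<or> d \<noteq> 0 \<longrightarrow> wsum c d (\<lambda>x. F (x + a) - F x) = 0)"
    (is "_ \<longleftrightarrow> ?R")
proof
  assume "bent F"
  then show ?R
    unfolding bent_def by (intro allI impI wsum_equidistributed) auto
next
  assume R: ?R
  have "real (card {x. F (x + a) - F x = b}) = 2 powi (int CARD('n) - int CARD(2))"
    if "a \<noteq> 0" for a b
  proof -
    have "real (card {x. F (x + a) - F x = b}) = 2 ^ CARD('n) / 4"
      using R that by (simp add: card_fibre)
    also have "\<dots> = 2 powi (int CARD('n) - int CARD(2))"
      by (simp add: power_int_diff)
    finally show ?thesis .
  qed
  then show "bent F" by (simp add: bent_def)
qed

text \<open>Substituting y = x + a in the double sum turns it into a sum of derivative sums over all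
  directions a. Bentness kills all but a = 0, which contributes 2^n.\<close>

lemma wsum_square:
  fixes F :: "bit ^ 'n \<Rightarrow> bit ^ 2"
  assumes "bent F" and cd: "c \<noteq> 0 \<or> d \<noteq> 0"
  shows "(wsum c d F)\<^sup>2 = 2 ^ CARD('n)"
proof -
  let ?g = "\<lambda>x. c * F x $ 1 + d * F x $ 2"
  have "(wsum c d F)\<^sup>2 = (\<Sum>x\<in>UNIV. \<Sum>y\<in>UNIV. chi (?g x) * chi (?g y))"
    by (simp add: wsum_def power2_eq_square sum_product)
  also have "\<dots> = (\<Sum>x\<in>UNIV. \<Sum>a\<in>UNIV. chi (?g x) * chi (?g (x + a)))"
  proof (rule sum.cong[OF refl])
    fix x
    show "(\<Sum>y\<in>UNIV. chi (?g x) * chi (?g y)) = (\<Sum>a\<in>UNIV. chi (?g x) * chi (?g (x + a)))"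
      by (rule sum.reindex_bij_witness[of _ "\<lambda>a. x + a" "\<lambda>y. y - x"]) auto
  qed
  also have "\<dots> = (\<Sum>a\<in>UNIV. \<Sum>x\<in>UNIV. chi (?g x) * chi (?g (x + a)))"
    by (rule sum.swap)
  also have "\<dots> = (\<Sum>a\<in>UNIV. wsum c d (\<lambda>x. F (x + a) - F x))"
    by (simp add: wsum_def bit_vec_minus algebra_simps flip: chi_add)
  also have "\<dots> = (\<Sum>a\<in>{0}. wsum c d (\<lambda>x. F (x + a) - F x))"
    using assms by (intro sum.mono_neutral_right) (auto simp: bent_iff_wsum)
  also have "\<dots> = 2 ^ CARD('n)"
    by (simp add: wsum_def)
  finally show ?thesis .
qed

section \<open>The two preimage distributions\<close>

definition wprod :: "('a::finite \<Rightarrow> bit ^ 2) \<Rightarrow> real" where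
  "wprod F = wsum 1 0 F * wsum 0 1 F * wsum 1 1 F"

text \<open>Each fibre size is governed by three signs whose product is the same \<sigma> for every
  \<beta>. Either all three equal \<sigma> and add up to 3\<sigma>, or exactly two are opposite and
  the sum is -\<sigma>.\<close>

lemma bent_distribution:
  fixes F :: "bit ^ 'n \<Rightarrow> bit ^ 2"
  assumes "bent F"
  defines "q \<equiv> 2 powr (real CARD('n) / 2)"
  obtains \<sigma> \<alpha> where "\<sigma> = 1 \<or> \<sigma> = - 1" and "wprod F = \<sigma> * q ^ 3"
    and "real (card (F -` {\<alpha>})) = (q\<^sup>2 + 3 * \<sigma> * q) / 4"
    and "\<And>\<beta>. \<beta> \<noteq> \<alpha> \<Longrightarrow> real (card (F -` {\<beta>})) = (q\<^sup>2 - \<sigma> * q) / 4"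
proof -
  have q2: "q\<^sup>2 = 2 ^ CARD('n)"
    by (simp add: q_def power2_eq_square flip: powr_add powr_realpow)
  have sign: "\<exists>s. wsum c d F = chi s * q" if "c \<noteq> 0 \<or> d \<noteq> 0" for c d
  proof -
    have "(wsum c d F)\<^sup>2 = q\<^sup>2"
      using wsum_square[OF \<open>bent F\<close> that] q2 by simp
    then have "wsum c d F = chi 0 * q \<or> wsum c d F = chi 1 * q"
      by (auto simp: power2_eq_iff)
    then show ?thesis by blast
  qed
  obtain s1 where s1: "wsum 1 0 F = chi s1 * q" using sign[of 1 0] by auto
  obtain s2 where s2: "wsum 0 1 F = chi s2 * q" using sign[of 0 1] by auto
  obtain s3 where s3: "wsum 1 1 F = chi s3 * q" using sign[of 1 1] by auto
  define t where "t = s1 + s2 + s3"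
  \<comment> \<open>This is the only point where the first two signs are both \<open>chi t\<close>;
    the third sign then agrees because \<open>t = s1 + s2 + s3\<close>.\<close>
  define \<alpha> :: "bit ^ 2" where "\<alpha> = vector [s1 + t, s2 + t]"
  have fibre: "real (card (F -` {\<beta>})) = (q\<^sup>2 + (chi (\<beta> $ 1 + s1) + chi (\<beta> $ 2 + s2)
      + chi (\<beta> $ 1 + \<beta> $ 2 + s3)) * q) / 4" for \<beta>
  proof -
    have "F -` {\<beta>} = {x. F x = \<beta>}" by auto
    then show ?thesis
      using card_fibre[of F \<beta>] by (simp add: s1 s2 s3 chi_add q2 algebra_simps)
  qed
  show thesis
  proof (rule that)
    show "chi t = 1 \<or> chi t = - 1" by (cases t) simp_all
    show "wprod F = chi t * q ^ 3"
      by (simp add: wprod_def s1 s2 s3 t_def chi_add power3_eq_cube)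
    show "real (card (F -` {\<alpha>})) = (q\<^sup>2 + 3 * chi t * q) / 4"
      unfolding fibre \<alpha>_def t_def by (cases s1; cases s2; cases s3) simp_all
    show "real (card (F -` {\<beta>})) = (q\<^sup>2 - chi t * q) / 4" if "\<beta> \<noteq> \<alpha>" for \<beta>
      using that unfolding fibre \<alpha>_def t_def vec_eq_iff forall_2
      by (cases s1; cases s2; cases s3; cases "\<beta> $ 1"; cases "\<beta> $ 2") simp_all
  qed
qed

text \<open>The stated sizes come from 3q/4 = q - q/4 with q = 2^(n/2). The sign of
  \<open>wprod\<close> is recorded so that summing \<open>wprod\<close> over a family can reveal
  which types occur in it.\<close>

lemma bent_type:
  fixes F :: "bit ^ 'n \<Rightarrow> bit ^ 2"
  assumes "bent F"
  shows "type_plus F \<and> wprod F = (2 powr (real CARD('n) / 2)) ^ 3 \<or>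
    type_minus F \<and> wprod F = - ((2 powr (real CARD('n) / 2)) ^ 3)"
proof -
  define q where "q = 2 powr (real CARD('n) / 2)"
  obtain \<sigma> \<alpha> where \<sigma>: "\<sigma> = 1 \<or> \<sigma> = - 1" "wprod F = \<sigma> * q ^ 3"
    and \<alpha>: "real (card (F -` {\<alpha>})) = (q\<^sup>2 + 3 * \<sigma> * q) / 4"
    and \<beta>: "\<And>\<beta>. \<beta> \<noteq> \<alpha> \<Longrightarrow> real (card (F -` {\<beta>})) = (q\<^sup>2 - \<sigma> * q) / 4"
    by (rule bent_distribution[OF assms, folded q_def]) (rule that)
  have q4: "2 powr (real CARD('n) / 2 - 2) = q / 4"
    by (simp add: q_def powr_diff)
  have "q\<^sup>2 = 2 powr real CARD('n)"
    by (simp add: q_def power2_eq_square flip: powr_add)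
  then have N4: "2 powr (real CARD('n) - 2) = q\<^sup>2 / 4"
    by (simp add: powr_diff)
  from \<sigma>(1) show ?thesis
  proof
    assume "\<sigma> = 1"
    then have "type_plus F"
      unfolding type_plus_def q4 N4 q_def[symmetric]
      by (intro exI[of _ \<alpha>] conjI allI impI) (simp_all add: \<alpha> \<beta> add_divide_distrib diff_divide_distrib)
    then show ?thesis using \<sigma> \<open>\<sigma> = 1\<close> by (simp add: q_def)
  next
    assume "\<sigma> = - 1"
    then have "type_minus F"
      unfolding type_minus_def q4 N4 q_def[symmetric]
      by (intro exI[of _ \<alpha>] conjI allI impI) (simp_all add: \<alpha> \<beta> add_divide_distrib diff_divide_distrib)
    then show ?thesis using \<sigma> \<open>\<sigma> = - 1\<close> by (simp add: q_def)
  qed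
qed

section \<open>Linear forms, and both types from one bent function\<close>

definition bdot :: "bit ^ 'n \<Rightarrow> bit ^ 'n \<Rightarrow> bit" where
  "bdot a x = (\<Sum>i\<in>UNIV. a $ i * x $ i)"

lemma bdot_add_left: "bdot (a + b) x = bdot a x + bdot b x"
  by (simp add: bdot_def algebra_simps sum.distrib)

lemma bdot_add_right: "bdot a (x + y) = bdot a x + bdot a y"
  by (simp add: bdot_def algebra_simps sum.distrib)

lemma sum_chi_bdot: "(\<Sum>a\<in>UNIV. chi (bdot a x)) = (if x = 0 then 2 ^ CARD('n) else 0)"
  for x :: "bit ^ 'n"
proof (cases "x = 0")
  case True
  then show ?thesis by (simp add: bdot_def)
next
  case False
  then obtain i where "x $ i = 1" by (auto simp: vec_eq_iff)
  then have "bdot (axis i 1) x = 1"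
    by (simp add: bdot_def axis_def of_bool_def if_distrib[of "\<lambda>b. b * _"] cong: if_cong)
  then have "(\<Sum>a\<in>UNIV. chi (bdot a x)) = 0"
    by (rule sum_chi_additive[rotated]) (rule bdot_add_left)
  then show ?thesis using False by simp
qed

text \<open>Only the first component moves, so \<open>wsum 0 1\<close> is common to all shears of
  \<open>F\<close>.\<close>

definition shear :: "(bit ^ 'n \<Rightarrow> bit ^ 2) \<Rightarrow> bit ^ 'n \<Rightarrow> bit ^ 'n \<Rightarrow> bit ^ 2" where
  "shear F a x = F x + axis 1 (bdot a x)"

lemma shear_nth [simp]: "shear F a x $ 1 = F x $ 1 + bdot a x" "shear F a x $ 2 = F x $ 2"
  by (simp_all add: shear_def axis_def)

text \<open>A linear form changes the derivative in direction \<open>v\<close> by a constant, which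
  multiplies its character sums by a sign.\<close>

lemma bent_shear:
  assumes "bent F"
  shows "bent (shear F a)"
proof -
  have "wsum c d (\<lambda>x. shear F a (x + v) - shear F a x)
      = chi (c * bdot a v) * wsum c d (\<lambda>x. F (x + v) - F x)" for v c d
    unfolding wsum_def sum_distrib_left
    by (intro sum.cong refl, unfold chi_add[symmetric], rule arg_cong[where f = chi])
      (simp add: bdot_add_right algebra_simps bit_vec_minus)
  then show ?thesis using assms by (simp add: bent_iff_wsum)
qed

text \<open>The factor \<open>wsum 0 1 F\<close> comes out. In the product of the other two sums,
  orthogonality over \<open>a\<close> forces x = y, where the two copies of the first component
  cancel; what remains is 2^n times \<open>wsum 0 1 F\<close> once more.\<close>

lemma sum_wprod_shear:
  fixes F :: "bit ^ 'n \<Rightarrow> bit ^ 2"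
  assumes "bent F"
  shows "(\<Sum>a\<in>UNIV. wprod (shear F a)) = (2 ^ CARD('n))\<^sup>2"
proof -
  let ?f = "\<lambda>x. F x $ 1" and ?g = "\<lambda>x. F x $ 2"
  have "(\<Sum>a\<in>UNIV. wsum 1 0 (shear F a) * wsum 1 1 (shear F a))
      = (\<Sum>a\<in>UNIV. \<Sum>x\<in>UNIV. \<Sum>y\<in>UNIV. chi (?f x + ?f y + ?g y) * chi (bdot a (x - y)))"
    by (simp add: wsum_def sum_product bit_vec_minus bdot_add_right algebra_simps flip: chi_add)
  also have "\<dots> = (\<Sum>x\<in>UNIV. \<Sum>y\<in>UNIV. \<Sum>a\<in>UNIV. chi (?f x + ?f y + ?g y) * chi (bdot a (x - y)))"
    by (rule trans[OF sum.swap], rule sum.cong[OF refl], rule sum.swap)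
  also have "\<dots> = (\<Sum>x\<in>UNIV. \<Sum>y\<in>UNIV. if x = y then 2 ^ CARD('n) * chi (?g y) else 0)"
    by (intro sum.cong refl) (simp add: sum_chi_bdot chi_add flip: sum_distrib_left, simp add: chi_def)
  also have "\<dots> = 2 ^ CARD('n) * wsum 0 1 F"
    by (simp add: wsum_def sum_distrib_left)
  finally have *: "(\<Sum>a\<in>UNIV. wsum 1 0 (shear F a) * wsum 1 1 (shear F a))
      = 2 ^ CARD('n) * wsum 0 1 F" .
  have "wsum 0 1 (shear F a) = wsum 0 1 F" for a
    by (simp add: wsum_def)
  then have "(\<Sum>a\<in>UNIV. wprod (shear F a))
      = (\<Sum>a\<in>UNIV. wsum 1 0 (shear F a) * wsum 1 1 (shear F a)) * wsum 0 1 F"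
    by (simp add: wprod_def sum_distrib_left mult_ac)
  also have "\<dots> = 2 ^ CARD('n) * (wsum 0 1 F)\<^sup>2"
    by (simp add: * power2_eq_square)
  finally show ?thesis
    using wsum_square[OF assms, of 0 1] by (simp add: power2_eq_square)
qed

lemma bent_both_types:
  fixes F :: "bit ^ 'n \<Rightarrow> bit ^ 2"
  assumes "bent F"
  shows "\<exists>a. type_plus (shear F a)" and "\<exists>a. type_minus (shear F a)"
proof -
  define q where "q = 2 powr (real CARD('n) / 2)"
  have q2: "2 ^ CARD('n) = q\<^sup>2"
    by (simp add: q_def power2_eq_square flip: powr_add powr_realpow)
  have q: "q > 1" by (simp add: q_def)
  have sum: "(\<Sum>a\<in>UNIV. wprod (shear F a)) = q ^ 4"
    using sum_wprod_shear[OF assms] by (simp add: q2)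
  note type = bent_type[OF bent_shear[OF assms], folded q_def]
  have const: "(\<Sum>a\<in>(UNIV :: (bit ^ 'n) set). r) = q\<^sup>2 * r" for r :: real
    by (simp add: q2)
  show "\<exists>a. type_plus (shear F a)"
  proof (rule ccontr)
    assume "\<not> ?thesis"
    then have "wprod (shear F a) = - (q ^ 3)" for a using type[of a] by auto
    then have "q ^ 4 = q\<^sup>2 * - (q ^ 3)" using sum by (simp only: const)
    moreover have "q ^ 4 > 0" "q\<^sup>2 * q ^ 3 > 0" using q by simp_all
    ultimately show False by simp
  qed
  show "\<exists>a. type_minus (shear F a)"
  proof (rule ccontr)
    assume "\<not> ?thesis"
    then have "wprod (shear F a) = q ^ 3" for a using type[of a] by auto
    then have "q ^ 4 = q\<^sup>2 * q ^ 3" using sum by (simp only: const)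
    also have "\<dots> = q ^ 5" by (simp flip: power_add)
    finally show False using q by simp
  qed
qed

section \<open>Quadratic bent functions in even dimension\<close>

text \<open>The hypotheses are the rows of (cI + dM)x = 0, where M is the companion matrix of
  X^(m+1) + X + 1, a polynomial without roots in F_2. For c = d = 1 they make x constant, and the
  last row becomes 3 * x 0 = x 0 = 0.\<close>

lemma shift_kernel:
  fixes x :: "nat \<Rightarrow> bit"
  assumes "c \<noteq> 0 \<or> d \<noteq> 0" and "m \<ge> 1"
    and step: "\<And>i. i < m \<Longrightarrow> c * x i + d * x (Suc i) = 0"
    and last: "c * x m + d * (x 0 + x 1) = 0"
    and "i \<le> m"
  shows "x i = 0"
proof (cases "d = 0")
  case True
  then show ?thesis
    using assms by (cases "i = m") auto
next
  case False
  then have d: "d = 1" by simp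
  show ?thesis
  proof (cases "c = 0")
    case True
    have pos: "x j = 0" if "j \<ge> 1" "j \<le> m" for j
      using step[of "j - 1"] that True d by simp
    then have "x 0 = 0" using last pos[of 1] True d \<open>m \<ge> 1\<close> by simp
    then show ?thesis using pos[of i] \<open>i \<le> m\<close> by (cases i) simp_all
  next
    case False
    have const: "x j = x 0" if "j \<le> m" for j
      using that
    proof (induction j)
      case (Suc j)
      then show ?case using step[of j] False d by (cases "x 0"; cases "x (Suc j)") simp_all
    qed simp
    have "x 0 = 0"
      using last const[of 1] const[of m] False d \<open>m \<ge> 1\<close> by (cases "x 0") simp_all
    then show ?thesis using const[OF \<open>i \<le> m\<close>] by simp
  qed
qed

text \<open>The same for the transpose of cI + dM: the polar form of the quadratic form pairs the
  two halves of the coordinates, so each half yields its own kernel condition.\<close>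

lemma shift_transpose_kernel:
  fixes b :: "nat \<Rightarrow> bit"
  assumes "c \<noteq> 0 \<or> d \<noteq> 0" and "m \<ge> 1"
    and b0: "c * b 0 + d * b m = 0"
    and b1: "c * b 1 + d * (b 0 + b m) = 0"
    and step: "\<And>j. 1 \<le> j \<Longrightarrow> j < m \<Longrightarrow> c * b (Suc j) + d * b j = 0"
    and "i \<le> m"
  shows "b i = 0"
proof (cases "c = 0")
  case True
  then have "b m = 0" "b 0 = 0" "\<And>j. 1 \<le> j \<Longrightarrow> j < m \<Longrightarrow> b j = 0"
    using assms by auto
  then show ?thesis using \<open>i \<le> m\<close> by (cases "i = m"; cases "i = 0") auto
next
  case False
  then have c: "c = 1" by simp
  \<comment> \<open>Here \<open>b 0 = d * b m\<close>, so \<open>b 1 = d * (d + 1) * b m\<close>,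
    and d * (d + 1) = 0 in F_2.\<close>
  have "b 1 = 0"
    using b0 b1 c by (cases d; cases "b 0"; cases "b m") simp_all
  have pos: "b (Suc j) = 0" if "Suc j \<le> m" for j
    using that
  proof (induction j)
    case 0
    then show ?case using \<open>b 1 = 0\<close> by simp
  next
    case (Suc j)
    then show ?case using step[of "Suc j"] c by simp
  qed
  have "b m = 0" using pos[of "m - 1"] \<open>m \<ge> 1\<close> by simp
  then show ?thesis using b0 c pos \<open>i \<le> m\<close> by (cases i) simp_all
qed

lemma bent_exists:
  assumes "even CARD('n)" and "CARD('n) \<ge> 4"
  shows "\<exists>F :: bit ^ 'n \<Rightarrow> bit ^ 2. bent F"
proof -
  obtain k where k: "CARD('n) = 2 * k" using assms by blast
  \<comment> \<open>Each half of the coordinates is indexed by 0, ..., m; n \<ge> 4 gives m \<ge> 1,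
    so that a coordinate with index 1 exists.\<close>
  define m where "m = k - 1"
  have m: "CARD('n) = 2 * Suc m" "m \<ge> 1" using k assms by (auto simp: m_def)
  obtain e :: "nat \<Rightarrow> 'n" where e: "bij_betw e {0..<2 * Suc m} UNIV"
    using ex_bij_betw_nat_finite[of "UNIV :: 'n set"] m by auto
  define p where "p i = e i" for i
  define r where "r i = e (Suc m + i)" for i
  have e_eq: "e i = e j \<longleftrightarrow> i = j" if "i < 2 * Suc m" "j < 2 * Suc m" for i j
    using e that by (auto simp: bij_betw_def inj_on_def)
  have p_eq [simp]: "p i = p j \<longleftrightarrow> i = j" if "i \<le> m" "j \<le> m" for i j
    using that by (simp add: p_def e_eq)
  have r_eq [simp]: "r i = r j \<longleftrightarrow> i = j" if "i \<le> m" "j \<le> m" for i j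
    using that by (simp add: r_def e_eq)
  have pr [simp]: "p i \<noteq> r j" "r j \<noteq> p i" if "i \<le> m" "j \<le> m" for i j
    using that by (simp_all add: p_def r_def e_eq)
  have cover: "\<exists>i\<le>m. l = p i \<or> l = r i" for l
  proof -
    obtain j where j: "j < 2 * Suc m" "l = e j"
      using e by (force simp: bij_betw_def)
    show ?thesis
    proof (cases "j \<le> m")
      case True
      then show ?thesis using j by (auto simp: p_def)
    next
      case False
      then show ?thesis using j by (intro exI[of _ "j - Suc m"]) (auto simp: r_def)
    qed
  qed
  \<comment> \<open>\<open>p\<close> and \<open>r\<close> enumerate the coordinates of \<open>x\<close> and \<open>y\<close>, and \<open>L c d\<close> is \<open>cI + dM\<close> for the matrix
    \<open>M (x\<^sub>0, \<dots>, x\<^sub>m) = (x\<^sub>1, \<dots>, x\<^sub>m, x\<^sub>0 + x\<^sub>1)\<close>.\<close>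
  define L where "L c d i z =
      c * z $ p i + d * (if i < m then z $ p (Suc i) else z $ p 0 + z $ p 1)"
    for c d i and z :: "bit ^ 'n"
  have L_add: "L c d i (x + y) = L c d i x + L c d i y" for c d i x y
    by (simp add: L_def algebra_simps)
  define Q where "Q c d z = (\<Sum>i\<le>m. L c d i z * z $ r i)" for c d z
  define F where "F z = (vector [Q 1 0 z, Q 0 1 z] :: bit ^ 2)" for z
  \<comment> \<open>\<open>L\<close> is linear in (c, d), so all components of \<open>F\<close> are
    handled by one nondegeneracy argument.\<close>
  have F: "c * F z $ 1 + d * F z $ 2 = Q c d z" for c d z
    by (cases c; cases d) (simp_all add: F_def Q_def L_def algebra_simps flip: sum.distrib)
  \<comment> \<open>the polar form of the quadratic form \<open>Q c d\<close>\<close>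
  define h where "h c d a x = (\<Sum>i\<le>m. L c d i x * a $ r i + L c d i a * x $ r i)" for c d a x
  have h_add: "h c d a (x + y) = h c d a x + h c d a y" for c d a x y
    by (simp add: h_def L_add algebra_simps sum.distrib)
  have Q_add: "Q c d (x + a) = Q c d x + Q c d a + h c d a x" for c d a x
    by (simp add: Q_def h_def L_add algebra_simps sum.distrib)
  have nondegenerate: "a = 0" if cd: "c \<noteq> 0 \<or> d \<noteq> 0" and zero: "\<And>x. h c d a x = 0" for c d a
  proof -
    \<comment> \<open>\<open>L\<close> reads only the \<open>p\<close> coordinates, so testing the
      polar form on a unit vector at \<open>r j\<close> isolates row j of cI + dM applied to the x
      part of \<open>a\<close>.\<close>
    have La: "L c d j a = 0" if "j \<le> m" for j
    proof -
      have "h c d a (axis (r j) 1) = (\<Sum>i\<le>m. if i = j then L c d j a else 0)"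
        unfolding h_def using that m
        by (intro sum.cong refl) (auto simp: L_def axis_def)
      then show ?thesis using zero that by simp
    qed
    have ap: "a $ p j = 0" if "j \<le> m" for j
    proof (rule shift_kernel[of c d m "\<lambda>i. a $ p i" j])
      show "c * a $ p i + d * a $ p (Suc i) = 0" if "i < m" for i
        using La[of i] that by (simp add: L_def)
      show "c * a $ p m + d * (a $ p 0 + a $ p 1) = 0"
        using La[of m] by (simp add: L_def)
    qed (use cd m that in auto)
    \<comment> \<open>Unit vectors at \<open>p j\<close> give column j paired with the y part of
      \<open>a\<close>. The inner sum is the shift, empty of nonzero terms for j = 0; the last row
      of M meets columns 0 and 1.\<close>
    have eq: "c * a $ r j + d * ((\<Sum>i<m. if Suc i = j then a $ r i else 0)
        + (if j = 0 \<or> j = 1 then a $ r m else 0)) = 0" if "j \<le> m" for j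
    proof -
      have "h c d a (axis (p j) 1) = (\<Sum>i\<le>m. L c d i (axis (p j) 1) * a $ r i)"
        unfolding h_def using that by (intro sum.cong refl) (simp add: axis_def)
      also have "\<dots> = (\<Sum>i\<le>m. c * (if i = j then a $ r i else 0)
          + d * (if i < m then if Suc i = j then a $ r i else 0
                 else if j = 0 \<or> j = 1 then a $ r i else 0))"
        unfolding L_def using that m by (intro sum.cong refl) (auto simp: axis_def algebra_simps)
      also have "\<dots> = c * a $ r j + d * ((\<Sum>i<m. if Suc i = j then a $ r i else 0)
        + (if j = 0 \<or> j = 1 then a $ r m else 0))"
        using that by (simp add: sum.distrib distrib_left flip: sum_distrib_left lessThan_Suc_atMost)
      finally show ?thesis using zero by simp
    qed
    have ar: "a $ r j = 0" if "j \<le> m" for j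
    proof (rule shift_transpose_kernel[of c d m "\<lambda>i. a $ r i" j])
      show "c * a $ r 0 + d * a $ r m = 0" using eq[of 0] by simp
      show "c * a $ r 1 + d * (a $ r 0 + a $ r m) = 0" using eq[of 1] m by simp
      show "c * a $ r (Suc j) + d * a $ r j = 0" if "1 \<le> j" "j < m" for j
        using eq[of "Suc j"] that by simp
    qed (use cd m that in auto)
    show "a = 0"
      using ap ar cover by (metis vec_eq_iff zero_index)
  qed
  have "bent F"
    unfolding bent_iff_wsum
  proof (intro allI impI)
    fix a :: "bit ^ 'n" and c d :: bit
    assume "a \<noteq> 0" and cd: "c \<noteq> 0 \<or> d \<noteq> 0"
    then obtain v where v: "h c d a v = 1"
      using nondegenerate by (metis bit_not_zero_iff)
    \<comment> \<open>The derivative of a quadratic form is affine, and its linear part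
      \<open>h c d a\<close> is nonzero by nondegeneracy.\<close>
    have "c * (F (x + a) - F x) $ 1 + d * (F (x + a) - F x) $ 2 = Q c d a + h c d a x" for x
    proof -
      have "c * (F (x + a) - F x) $ 1 + d * (F (x + a) - F x) $ 2
          = (c * F (x + a) $ 1 + d * F (x + a) $ 2) - (c * F x $ 1 + d * F x $ 2)"
        by (simp add: algebra_simps del: minus_bit_def)
      then show ?thesis by (simp add: F Q_add del: minus_bit_def)
    qed
    then have "wsum c d (\<lambda>x. F (x + a) - F x) = chi (Q c d a) * (\<Sum>x\<in>UNIV. chi (h c d a x))"
      by (simp add: wsum_def chi_add sum_distrib_left)
    then show "wsum c d (\<lambda>x. F (x + a) - F x) = 0"
      using sum_chi_additive[of "h c d a" v] h_add v by simp
  qed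
  then show ?thesis by blast
qed

theorem theorem5p3:
  shows "(\<forall>F :: bit ^ 'n \<Rightarrow> bit ^ 2. bent F \<longrightarrow> type_plus F \<or> type_minus F) \<and>
    (even CARD('n) \<and> CARD('n) \<ge> 4 \<longrightarrow>
      (\<exists>F :: bit ^ 'n \<Rightarrow> bit ^ 2. bent F \<and> type_plus F) \<and>
      (\<exists>F :: bit ^ 'n \<Rightarrow> bit ^ 2. bent F \<and> type_minus F))"
proof (intro conjI impI allI)
  show "type_plus F \<or> type_minus F" if "bent F" for F :: "bit ^ 'n \<Rightarrow> bit ^ 2"
    using bent_type[OF that] by blast
next
  assume "even CARD('n) \<and> CARD('n) \<ge> 4"
  then obtain F :: "bit ^ 'n \<Rightarrow> bit ^ 2" where "bent F" using bent_exists by blast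
  then show "\<exists>F :: bit ^ 'n \<Rightarrow> bit ^ 2. bent F \<and> type_plus F"
    and "\<exists>F :: bit ^ 'n \<Rightarrow> bit ^ 2. bent F \<and> type_minus F"
    using bent_both_types bent_shear by blast+
qed

end
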